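(* Let $P$ be a poset and $\prec$ a pre-approximating auxiliary relation on $P$. Then the collection of all $\prec$-open subsets of $P$ is a topology on $P$.
   Context: For a poset $(P,\le)$ and $X\subseteq P$, $\mathord{\uparrow}X=\{x\mid \exists y\in X,\ y\le x\}$; $X$ is upper if $X=\mathord{\uparrow}X$. A subset is directed if it is nonempty and every finite subset has an upper bound in it. An auxiliary relation on $P$ is a binary relation $\prec$ such that: $x\prec y$ implies $x\le y$; $u\le x\prec y\le z$ implies $u\prec z$; if $P$ has a least element $\bot$ then $\bot\prec x$ for all $x$. Write $s_\prec(x)=\{y\mid y\prec x\}$; $\prec$ is pre-approximating if $s_\prec(x)$ is directed for every $x\in P$. For $A\subseteq P$, $A^{\downarrow\prec}=\{x\in A\mid s_\prec(x)\cap A\ne\emptyset\}$. A subset $U\subseteq P$ is $\prec$-open if $U=\mathord{\uparrow}U$ and $U=U^{\downarrow\prec}$. *)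

theory Defs
  imports "HOL-Analysis.Abstract_Topology"
begin

text \<open>
  A poset is a carrier \<open>P\<close> with a relation \<open>le\<close> such that \<^term>\<open>partial_order_on P le\<close>;
  the carrier may be empty.  The set of all \<open>y\<close> with \<open>y \<prec> x\<close> is \<^term>\<open>under prec x\<close>.
\<close>

definition up_closure :: "'a rel \<Rightarrow> 'a set \<Rightarrow> 'a set" where
  "up_closure le X = {x. \<exists>y\<in>X. (y, x) \<in> le}"

definition directed :: "'a rel \<Rightarrow> 'a set \<Rightarrow> bool" where
  "directed le D \<longleftrightarrow>
    D \<noteq> {} \<and> (\<forall>F. finite F \<and> F \<subseteq> D \<longrightarrow> (\<exists>d\<in>D. \<forall>x\<in>F. (x, d) \<in> le))"

definition auxiliary_relation_on :: "'a set \<Rightarrow> 'a rel \<Rightarrow> 'a rel \<Rightarrow> bool" where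
  "auxiliary_relation_on P le prec \<longleftrightarrow>
    prec \<subseteq> P \<times> P \<and>
    (\<forall>x y. (x, y) \<in> prec \<longrightarrow> (x, y) \<in> le) \<and>
    (\<forall>u x y z. (u, x) \<in> le \<and> (x, y) \<in> prec \<and> (y, z) \<in> le \<longrightarrow> (u, z) \<in> prec) \<and>
    (\<forall>b\<in>P. (\<forall>x\<in>P. (b, x) \<in> le) \<longrightarrow> (\<forall>x\<in>P. (b, x) \<in> prec))"

definition pre_approximating :: "'a set \<Rightarrow> 'a rel \<Rightarrow> 'a rel \<Rightarrow> bool" where
  "pre_approximating P le prec \<longleftrightarrow> (\<forall>x\<in>P. directed le (under prec x))"

definition down_restrict :: "'a rel \<Rightarrow> 'a set \<Rightarrow> 'a set" where
  "down_restrict prec A = {x\<in>A. under prec x \<inter> A \<noteq> {}}"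

definition prec_open :: "'a set \<Rightarrow> 'a rel \<Rightarrow> 'a rel \<Rightarrow> 'a set \<Rightarrow> bool" where
  "prec_open P le prec U \<longleftrightarrow>
    U \<subseteq> P \<and> U = up_closure le U \<and> U = down_restrict prec U"

end

theory Submission
  imports Defs
begin

text \<open>A subset of \<open>P\<close> is open iff it is upper and each of its points has a
  \<open>prec\<close>-predecessor inside it. Both conditions pass to arbitrary unions. Directedness
  of the sets \<open>under prec x\<close> does the rest: nonemptiness makes \<open>P\<close> itself
  open (\<open>prec_open_carrier\<close>), and upper bounds of pairs give binary intersections
  (\<open>prec_open_Int\<close>).\<close>

text \<open>Turns the two fixpoint equations into closure conditions. Reflexivity of
  \<open>le\<close> on \<open>P\<close> gives \<open>U \<subseteq> up_closure le U\<close>, while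
  \<open>down_restrict prec U\<close> always lies in \<open>U\<close>, so each equation amounts to a
  single inclusion.\<close>

lemma prec_open_iff:
  assumes "partial_order_on P le"
  shows "prec_open P le prec U \<longleftrightarrow>
    U \<subseteq> P \<and> (\<forall>x y. x \<in> U \<longrightarrow> (x, y) \<in> le \<longrightarrow> y \<in> U) \<and> (\<forall>x\<in>U. \<exists>y\<in>U. (y, x) \<in> prec)"
proof -
  have "(x, x) \<in> le" if "x \<in> P" for x
    using assms that by (auto simp: partial_order_on_def preorder_on_def refl_on_def)
  then have "U \<subseteq> up_closure le U" if "U \<subseteq> P"
    using that by (auto simp: up_closure_def)
  then have "U \<subseteq> P \<and> U = up_closure le U \<longleftrightarrow> U \<subseteq> P \<and> up_closure le U \<subseteq> U"
    by blast
  moreover have "up_closure le U \<subseteq> U \<longleftrightarrow> (\<forall>x y. x \<in> U \<longrightarrow> (x, y) \<in> le \<longrightarrow> y \<in> U)"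
    by (auto simp: up_closure_def)
  moreover have "U = down_restrict prec U \<longleftrightarrow> (\<forall>x\<in>U. \<exists>y\<in>U. (y, x) \<in> prec)"
    by (auto simp: down_restrict_def under_def set_eq_iff)
  ultimately show ?thesis
    unfolding prec_open_def by metis
qed

text \<open>Predecessors exist because directed sets are nonempty, and they lie in \<open>P\<close>
  because \<open>prec\<close> is a relation on \<open>P\<close>.\<close>

lemma prec_open_carrier:
  assumes "partial_order_on P le" and "pre_approximating P le prec"
    and "auxiliary_relation_on P le prec"
  shows "prec_open P le prec P"
proof -
  have "le \<subseteq> P \<times> P"
    using assms(1) by (auto simp: partial_order_on_def preorder_on_def)
  moreover have "\<exists>y\<in>P. (y, x) \<in> prec" if "x \<in> P" for x
  proof -
    have "under prec x \<noteq> {}"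
      using assms(2) that by (simp add: pre_approximating_def directed_def)
    moreover have "prec \<subseteq> P \<times> P"
      using assms(3) by (simp add: auxiliary_relation_on_def)
    ultimately show ?thesis
      by (auto simp: under_def)
  qed
  ultimately show ?thesis
    by (auto simp: prec_open_iff[OF assms(1)])
qed

lemma prec_open_Int:
  assumes po: "partial_order_on P le" and pre: "pre_approximating P le prec"
    and U: "prec_open P le prec U" and V: "prec_open P le prec V"
  shows "prec_open P le prec (U \<inter> V)"
proof -
  have up: "y \<in> W" if "prec_open P le prec W" "x \<in> W" "(x, y) \<in> le" for W x y
    using that prec_open_iff[OF po] by metis
  have pred: "\<exists>y\<in>W. (y, x) \<in> prec" if "prec_open P le prec W" "x \<in> W" for W x
    using that prec_open_iff[OF po] by metis
  have subset: "U \<inter> V \<subseteq> P"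
    using U by (auto simp: prec_open_def)
  have "\<exists>w\<in>U \<inter> V. (w, x) \<in> prec" if x: "x \<in> U \<inter> V" for x
  proof -
    \<comment> \<open>Openness yields one predecessor of \<open>x\<close> in each set. A common
      upper bound \<open>w\<close> of both that is still a predecessor of \<open>x\<close> lies in
      \<open>U\<close> and in \<open>V\<close>, since both are upper.\<close>
    obtain u v where uv: "u \<in> U" "(u, x) \<in> prec" "v \<in> V" "(v, x) \<in> prec"
      using pred[OF U, of x] pred[OF V, of x] x by blast
    have "directed le (under prec x)"
      using pre x subset by (auto simp: pre_approximating_def)
    moreover have "finite {u, v}" "{u, v} \<subseteq> under prec x"
      using uv by (auto simp: under_def)
    ultimately obtain w where "w \<in> under prec x" "\<forall>y\<in>{u, v}. (y, w) \<in> le"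
      unfolding directed_def by meson
    then have "(w, x) \<in> prec" "(u, w) \<in> le" "(v, w) \<in> le"
      by (auto simp: under_def)
    then show ?thesis
      using up[OF U uv(1)] up[OF V uv(3)] by blast
  qed
  then show ?thesis
    using up[OF U] up[OF V] subset by (simp add: prec_open_iff[OF po]) metis
qed

text \<open>A witness found in one member of the family stays in the union. The empty family makes
  \<open>{}\<close> open.\<close>

lemma prec_open_Union:
  assumes "partial_order_on P le" and "\<And>U. U \<in> \<U> \<Longrightarrow> prec_open P le prec U"
  shows "prec_open P le prec (\<Union>\<U>)"
  using assms(2) by (simp add: prec_open_iff[OF assms(1)]) (meson Sup_least)

theorem theorem3p15:
  fixes P :: "'a set" and le prec :: "'a rel"
  assumes "partial_order_on P le"
    and "auxiliary_relation_on P le prec"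
    and "pre_approximating P le prec"
  shows "istopology (prec_open P le prec) \<and> topspace (topology (prec_open P le prec)) = P"
proof
  show top: "istopology (prec_open P le prec)"
    unfolding istopology_def
    using prec_open_Int[OF assms(1,3)] prec_open_Union[OF assms(1)] by simp
  \<comment> \<open>\<open>topspace\<close> is the union of all open sets: it is contained in
    \<open>P\<close> by this bound, and equals \<open>P\<close> because \<open>P\<close> is itself
    open.\<close>
  have "{U. prec_open P le prec U} \<subseteq> Pow P"
    by (auto simp: prec_open_def)
  then show "topspace (topology (prec_open P le prec)) = P"
    using prec_open_carrier[OF assms(1,3,2)]
    by (auto simp: topspace_def topology_inverse'[OF top])
qed

end
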